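(* Let $\Omega$ be a topological space, $T_1,\dots,T_\gamma$ commuting homeomorphisms of $\Omega$, $T^n=T_1^{n_1}\cdots T_\gamma^{n_\gamma}$, $\mu$ a Borel measure on $\Omega$ ergodic for this $\mathbb{Z}^\gamma$-action, $f:\Omega\to\mathbb{R}$ continuous, and $(H_\omega u)(n)=\sum_{|m-n|=1}u(m)+f(T^n\omega)u(n)$ on $\ell^2(\mathbb{Z}^\gamma)$. If $H_\omega$ has uniformly localized eigenfunctions (ULE) for $\mu$-a.e. $\omega\in\Omega$, then there exists $\alpha>0$ independent of $\omega$ such that for $\mu$-a.e. $\omega$ there is a constant $C_\omega>0$, a complete orthonormal set of eigenfunctions $\{\phi^\omega_n\}$ of $H_\omega$ and points $m^\omega_n\in\mathbb{Z}^\gamma$ with $|\phi_n^\omega(m)|\le C_\omega e^{-\alpha|m-m_n^\omega|}$ for all $n$ and $m$.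
   Context: A self-adjoint operator $H$ on $\ell^2(\mathbb{Z}^\gamma)$ has ULE if it has a complete orthonormal set of eigenfunctions $\{\phi_n\}$ and there exist $\alpha>0$, $C>0$ and points $m_n\in\mathbb{Z}^\gamma$ such that $|\phi_n(m)|\le Ce^{-\alpha|m-m_n|}$ for all $n,m$. *)

theory Defs
  imports "HOL-Analysis.Analysis"
begin

text \<open>Lattice points of Z^gamma are functions from a finite nonempty index type 'd to int.
  The norm |m| is the l1 norm (so |m - n| = 1 means nearest neighbours).\<close>

definition lat_norm :: "('d::finite \<Rightarrow> int) \<Rightarrow> real" where
  "lat_norm m = (\<Sum>i\<in>UNIV. real_of_int \<bar>m i\<bar>)"

definition lat_diff :: "('d::finite \<Rightarrow> int) \<Rightarrow> ('d \<Rightarrow> int) \<Rightarrow> ('d \<Rightarrow> int)" where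
  "lat_diff m n = (\<lambda>i. m i - n i)"

definition lat_add :: "('d::finite \<Rightarrow> int) \<Rightarrow> ('d \<Rightarrow> int) \<Rightarrow> ('d \<Rightarrow> int)" where
  "lat_add m n = (\<lambda>i. m i + n i)"

definition lat_unit :: "'d::finite \<Rightarrow> ('d \<Rightarrow> int)" where
  "lat_unit i = (\<lambda>j. if j = i then 1 else 0)"

definition schr_op :: "(('d::finite \<Rightarrow> int) \<Rightarrow> real) \<Rightarrow> (('d \<Rightarrow> int) \<Rightarrow> complex)
    \<Rightarrow> ('d \<Rightarrow> int) \<Rightarrow> complex" where
  "schr_op V u n = (\<Sum>m\<in>{m. lat_norm (lat_diff m n) = 1}. u m) + complex_of_real (V n) * u n"

definition in_l2 :: "(('d::finite \<Rightarrow> int) \<Rightarrow> complex) \<Rightarrow> bool" where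
  "in_l2 u \<longleftrightarrow> (\<lambda>m. (norm (u m))\<^sup>2) summable_on UNIV"

definition l2_inner :: "(('d::finite \<Rightarrow> int) \<Rightarrow> complex) \<Rightarrow> (('d \<Rightarrow> int) \<Rightarrow> complex) \<Rightarrow> complex" where
  "l2_inner u v = infsum (\<lambda>m. u m * cnj (v m)) UNIV"

definition is_eigenfunction :: "(('d::finite \<Rightarrow> int) \<Rightarrow> real) \<Rightarrow> (('d \<Rightarrow> int) \<Rightarrow> complex) \<Rightarrow> bool" where
  "is_eigenfunction V u \<longleftrightarrow> in_l2 u \<and> (\<exists>m. u m \<noteq> 0) \<and>
     (\<exists>E::real. \<forall>n. schr_op V u n = complex_of_real E * u n)"

text \<open>Complete orthonormal set of eigenfunctions (indexed by nat; l2(Z^gamma) is separable and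
  infinite-dimensional).  Completeness: only the zero vector is orthogonal to all of them.\<close>

definition complete_ON_eigenbasis :: "(('d::finite \<Rightarrow> int) \<Rightarrow> real) \<Rightarrow> (nat \<Rightarrow> ('d \<Rightarrow> int) \<Rightarrow> complex) \<Rightarrow> bool" where
  "complete_ON_eigenbasis V \<phi> \<longleftrightarrow>
     (\<forall>k. is_eigenfunction V (\<phi> k)) \<and>
     (\<forall>k l. l2_inner (\<phi> k) (\<phi> l) = (if k = l then 1 else 0)) \<and>
     (\<forall>u. in_l2 u \<and> (\<forall>k. l2_inner u (\<phi> k) = 0) \<longrightarrow> u = (\<lambda>m. 0))"

definition ULE_rate :: "(('d::finite \<Rightarrow> int) \<Rightarrow> real) \<Rightarrow> real \<Rightarrow> bool" where
  "ULE_rate V \<alpha> \<longleftrightarrow> (\<exists>C>0. \<exists>\<phi> c. complete_ON_eigenbasis V \<phi> \<and>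
      (\<forall>k m. norm (\<phi> k m) \<le> C * exp (- \<alpha> * lat_norm (lat_diff m (c k)))))"

definition ULE :: "(('d::finite \<Rightarrow> int) \<Rightarrow> real) \<Rightarrow> bool" where
  "ULE V \<longleftrightarrow> (\<exists>\<alpha>>0. ULE_rate V \<alpha>)"

definition ergodic_action :: "'a measure \<Rightarrow> (('d::finite \<Rightarrow> int) \<Rightarrow> 'a \<Rightarrow> 'a) \<Rightarrow> bool" where
  "ergodic_action M Tn \<longleftrightarrow>
     (\<forall>n. \<forall>S\<in>sets M. Tn n -` S \<inter> space M \<in> sets M \<and> emeasure M (Tn n -` S \<inter> space M) = emeasure M S) \<and>
     (\<forall>S\<in>sets M. (\<forall>n. Tn n -` S \<inter> space M = S) \<longrightarrow> emeasure M S = 0 \<or> emeasure M (space M - S) = 0)"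

end

theory Submission
  imports Defs
begin

text \<open>Uniform localization with given constants is a closed condition on the potential. A basis
  with the bound \<open>C exp (- \<alpha> |m - m_n|)\<close> has at most \<open>D\<close> functions per centre, because each of them
  has mass at least \<open>1/2\<close> in a fixed box around its centre and Bessel's inequality bounds the total
  mass per site. Indexing the basis by (centre, slot) turns it into a point of a compact product
  of discs, on which the eigenvalue equation, orthonormality and Parseval's identity (equivalent to
  completeness) are closed conditions by dominated convergence. Hence the set of \<open>\<omega>\<close> admitting such a
  basis is the projection of a closed set along a compact factor, so it is closed; it is invariant
  under translations, so by ergodicity it is null or conull. Countably many of these sets, for
  \<open>\<alpha> = 1 / (j + 1)\<close> and natural \<open>C\<close> and \<open>D\<close>, cover the localized \<open>\<omega>\<close>.\<close>

section \<open>Exponential weights on the lattice\<close>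

lemma has_sum_finite_sum:
  fixes f :: "'k \<Rightarrow> 'b \<Rightarrow> 'c::topological_comm_monoid_add"
  assumes "finite F" "\<And>k. k \<in> F \<Longrightarrow> (f k has_sum s k) A"
  shows "((\<lambda>x. \<Sum>k\<in>F. f k x) has_sum (\<Sum>k\<in>F. s k)) A"
  using assms by (induction F) (auto intro: has_sum_add)

lemma summable_exp_int:
  assumes "\<alpha> > 0"
  shows "(\<lambda>k::int. exp (- \<alpha> * \<bar>real_of_int k\<bar>)) summable_on UNIV"
proof -
  have geo: "(\<lambda>n::nat. exp (- \<alpha>) ^ n) summable_on UNIV"
    using assms by (intro summable_nonneg_imp_summable_on) (auto intro!: summable_geometric)
  have eq: "exp (- \<alpha> * real n) = exp (- \<alpha>) ^ n" for n
    by (simp add: exp_of_nat_mult[symmetric] mult.commute)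
  have "(\<lambda>k::int. exp (- \<alpha> * \<bar>real_of_int k\<bar>)) summable_on (int ` UNIV)"
    using geo by (subst summable_on_reindex) (auto simp: o_def eq[simplified])
  moreover have "(\<lambda>k::int. exp (- \<alpha> * \<bar>real_of_int k\<bar>)) summable_on ((\<lambda>n. - int n) ` UNIV)"
    using geo by (subst summable_on_reindex) (auto simp: o_def eq[simplified] inj_on_def)
  moreover have "int ` UNIV \<union> (\<lambda>n. - int n) ` UNIV = UNIV"
    by (auto intro: int_cases2)
  ultimately show ?thesis
    using summable_on_union by fastforce
qed

text \<open>Because the norm is the l1 norm, the weight is a product over coordinates, so a sum over
  a cube is a power of a one-dimensional sum.\<close>

lemma summable_exp_lat_norm:
  assumes "\<alpha> > 0"
  shows "(\<lambda>m::'d::finite \<Rightarrow> int. exp (- \<alpha> * lat_norm m)) summable_on UNIV"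
proof (rule nonneg_bdd_above_summable_on)
  define g where "g = (\<lambda>k::int. exp (- \<alpha> * \<bar>real_of_int k\<bar>))"
  have eq: "exp (- \<alpha> * lat_norm m) = (\<Prod>i\<in>UNIV. g (m i))" for m :: "'d \<Rightarrow> int"
    by (simp add: lat_norm_def g_def sum_distrib_left exp_sum)
  show "bdd_above (sum (\<lambda>m::'d \<Rightarrow> int. exp (- \<alpha> * lat_norm m)) ` {F. F \<subseteq> UNIV \<and> finite F})"
  proof (rule bdd_aboveI2)
    fix F :: "('d \<Rightarrow> int) set" assume "F \<in> {F. F \<subseteq> UNIV \<and> finite F}"
    then have fin: "finite F" by simp
    \<comment> \<open>\<open>B\<close> collects every coordinate value occurring in
      \<open>F\<close>, so that \<open>F\<close> lies in the cube over \<open>B\<close>, where the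
      sum factorizes.\<close>
    define B where "B = (\<Union>m\<in>F. range m)"
    have "finite B" using fin by (auto simp: B_def)
    have "sum (\<lambda>m. exp (- \<alpha> * lat_norm m)) F \<le> (\<Sum>m\<in>PiE UNIV (\<lambda>_. B). \<Prod>i\<in>(UNIV::'d set). g (m i))"
      unfolding eq
    proof (rule sum_mono2)
      show "F \<subseteq> PiE UNIV (\<lambda>_. B)"
        by (auto simp: B_def)
    qed (auto simp: g_def \<open>finite B\<close> finite_PiE intro!: prod_nonneg)
    also have "\<dots> = (\<Prod>i\<in>(UNIV::'d set). \<Sum>k\<in>B. g k)"
      using \<open>finite B\<close> by (intro prod_sum_PiE[symmetric]) auto
    also have "\<dots> \<le> (\<Prod>i\<in>(UNIV::'d set). infsum g UNIV)"
      using summable_exp_int[OF assms] \<open>finite B\<close>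
      by (intro prod_mono) (auto simp: g_def intro!: finite_sum_le_infsum sum_nonneg)
    finally show "sum (\<lambda>m. exp (- \<alpha> * lat_norm m)) F \<le> (\<Prod>i\<in>(UNIV::'d set). infsum g UNIV)" .
  qed
qed auto

lemma lat_norm_nonneg [simp]: "0 \<le> lat_norm m"
  by (simp add: lat_norm_def sum_nonneg)

lemma lat_norm_diff_commute: "lat_norm (lat_diff m n) = lat_norm (lat_diff n m)"
  by (simp add: lat_norm_def lat_diff_def abs_minus_commute)

lemma bij_lat_diff_left: "bij (\<lambda>m. lat_diff m n)"
  by (rule bij_betw_byWitness[where f' = "\<lambda>m. lat_add m n"]) (auto simp: lat_diff_def lat_add_def)

lemma bij_lat_add_right: "bij (\<lambda>m. lat_add m n)"
  by (rule bij_betw_byWitness[where f' = "\<lambda>m. lat_diff m n"]) (auto simp: lat_diff_def lat_add_def)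

lemma summable_exp_lat_diff:
  fixes n :: "'d::finite \<Rightarrow> int"
  assumes "\<alpha> > 0"
  shows "(\<lambda>m. exp (- \<alpha> * lat_norm (lat_diff m n))) summable_on UNIV"
  using summable_on_reindex_bij_betw[OF bij_lat_diff_left, of "\<lambda>m. exp (- \<alpha> * lat_norm m)" n]
    summable_exp_lat_norm[OF assms] by simp

section \<open>Orthonormal systems and Parseval's identity\<close>

lemma l2_prod_abs_summable:
  assumes "in_l2 u" "in_l2 v"
  shows "(\<lambda>m. norm (u m * cnj (v m))) summable_on UNIV"
proof (rule Infinite_Sum.abs_summable_product)
  show "(\<lambda>m. norm (u m * u m)) summable_on UNIV"
    using assms(1) by (simp only: in_l2_def norm_mult power2_eq_square)
  show "(\<lambda>m. norm (cnj (v m) * cnj (v m))) summable_on UNIV"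
    using assms(2) by (simp only: in_l2_def norm_mult power2_eq_square complex_mod_cnj)
qed

lemma has_sum_l2_inner:
  assumes "in_l2 u" "in_l2 v"
  shows "((\<lambda>m. u m * cnj (v m)) has_sum l2_inner u v) UNIV"
  unfolding l2_inner_def
  using abs_summable_summable[OF l2_prod_abs_summable[OF assms]] by simp

lemma has_sum_l2_norm:
  assumes "in_l2 u"
  shows "((\<lambda>m. (norm (u m))\<^sup>2) has_sum Re (l2_inner u u)) UNIV"
proof -
  have "Re (u m * cnj (u m)) = (norm (u m))\<^sup>2" for m
    by (metis Re_complex_of_real complex_norm_square)
  then show ?thesis
    using has_sum_Re[OF has_sum_l2_inner[OF assms assms]] by simp
qed

definition orthonormal_l2 :: "('k \<Rightarrow> ('d::finite \<Rightarrow> int) \<Rightarrow> complex) \<Rightarrow> bool" where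
  "orthonormal_l2 \<phi> \<longleftrightarrow> (\<forall>k. in_l2 (\<phi> k)) \<and> (\<forall>k l. l2_inner (\<phi> k) (\<phi> l) = (if k = l then 1 else 0))"

lemma orthonormal_l2_has_sum_norm:
  assumes "orthonormal_l2 \<phi>"
  shows "((\<lambda>x. (norm (\<phi> k x))\<^sup>2) has_sum 1) UNIV"
  using has_sum_l2_norm[of "\<phi> k"] assms by (simp add: orthonormal_l2_def)

lemma orthonormal_l2_norm_le_1:
  assumes "orthonormal_l2 \<phi>"
  shows "norm (\<phi> k x) \<le> 1"
proof -
  have "sum (\<lambda>x. (norm (\<phi> k x))\<^sup>2) {x} \<le> 1"
    by (rule finite_sum_le_has_sum[OF orthonormal_l2_has_sum_norm[OF assms]]) auto
  then show ?thesis
    by (simp add: abs_square_le_1)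
qed

text \<open>Pythagoras: the squared modulus expands into a finite double sum, and after summation
  over the sites only the diagonal inner products survive.\<close>

lemma orthonormal_l2_has_sum_combination:
  assumes on: "orthonormal_l2 \<phi>" and "finite F"
  shows "((\<lambda>x. (norm (\<Sum>k\<in>F. a k * \<phi> k x))\<^sup>2) has_sum (\<Sum>k\<in>F. (norm (a k))\<^sup>2)) UNIV"
proof -
  have "((\<lambda>x. \<Sum>k\<in>F. \<Sum>l\<in>F. (a k * cnj (a l)) * (\<phi> k x * cnj (\<phi> l x))) has_sum
      (\<Sum>k\<in>F. \<Sum>l\<in>F. (a k * cnj (a l)) * l2_inner (\<phi> k) (\<phi> l))) UNIV"
    using on by (intro has_sum_finite_sum has_sum_cmult_right has_sum_l2_inner \<open>finite F\<close>)
      (auto simp: orthonormal_l2_def)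
  moreover have "(\<Sum>k\<in>F. \<Sum>l\<in>F. (a k * cnj (a l)) * (\<phi> k x * cnj (\<phi> l x))) =
      complex_of_real ((norm (\<Sum>k\<in>F. a k * \<phi> k x))\<^sup>2)" for x
    by (subst complex_norm_square) (simp add: sum_product algebra_simps)
  moreover have "(\<Sum>k\<in>F. \<Sum>l\<in>F. (a k * cnj (a l)) * l2_inner (\<phi> k) (\<phi> l)) =
      complex_of_real (\<Sum>k\<in>F. (norm (a k))\<^sup>2)"
    using on \<open>finite F\<close>
    by (simp add: orthonormal_l2_def complex_norm_square if_distrib[of "\<lambda>z. _ * z"]
        del: of_real_power cong: if_cong)
  ultimately show ?thesis
    unfolding has_sum_of_real_iff[symmetric, where ?'a = complex] by simp
qed

text \<open>This is Bessel's inequality for the unit vector at \<open>x\<close>. The projection of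
  that vector to the span of the \<open>\<phi> k\<close> with \<open>k \<in> F\<close> has value
  \<open>s\<close> at \<open>x\<close> and squared norm \<open>s\<close>, whence
  \<open>s * s \<le> s\<close>.\<close>

lemma bessel:
  assumes on: "orthonormal_l2 \<phi>" and "finite F"
  shows "(\<Sum>k\<in>F. (norm (\<phi> k x))\<^sup>2) \<le> 1"
proof -
  define s where "s = (\<Sum>k\<in>F. (norm (\<phi> k x))\<^sup>2)"
  have eq: "(\<Sum>k\<in>F. cnj (\<phi> k x) * \<phi> k x) = complex_of_real s"
    unfolding s_def of_real_sum by (simp add: complex_norm_square mult.commute del: of_real_power)
  have "sum (\<lambda>y. (norm (\<Sum>k\<in>F. cnj (\<phi> k x) * \<phi> k y))\<^sup>2) {x} \<le> (\<Sum>k\<in>F. (norm (cnj (\<phi> k x)))\<^sup>2)"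
    by (rule finite_sum_le_has_sum[OF orthonormal_l2_has_sum_combination[OF assms]]) auto
  then have "s\<^sup>2 \<le> s"
    by (simp add: eq s_def[symmetric])
  then show ?thesis
    unfolding s_def[symmetric] using mult_strict_right_mono[of 1 s s]
    by (force simp: power2_eq_square not_le[symmetric])
qed

text \<open>If \<open>u\<close> is orthogonal to all \<open>\<phi> k\<close>, then \<open>u x\<close> is the inner product of \<open>u\<close> with
  \<open>\<delta>\<^sub>x - (\<Sum>k\<in>F. cnj (\<phi> k x) \<cdot> \<phi> k)\<close>, whose norm is small for large \<open>F\<close>.\<close>

lemma parseval_imp_complete:
  assumes on: "orthonormal_l2 \<phi>"
    and parseval: "\<And>x. ((\<lambda>k. (norm (\<phi> k x))\<^sup>2) has_sum 1) UNIV"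
    and u: "in_l2 u" and orth: "\<And>k. l2_inner u (\<phi> k) = 0"
  shows "u x = 0"
proof -
  obtain U where U: "((\<lambda>y. (norm (u y))\<^sup>2) has_sum U) UNIV"
    using has_sum_l2_norm[OF u] by blast
  have U0: "0 \<le> U" by (rule has_sum_nonneg[OF U]) auto
  \<comment> \<open>A weighted arithmetic-geometric inequality with free weight \<open>t\<close>
    takes the place of Cauchy-Schwarz; \<open>e\<close> bounds \<open>1 - s\<close>, the squared
    norm of the remainder \<open>Q\<close>.\<close>
  have bound: "norm (u x) \<le> t * U + e / t" if "t > 0" "e > 0" for t e
  proof -
    obtain F where F: "finite F" "dist (\<Sum>k\<in>F. (norm (\<phi> k x))\<^sup>2) 1 \<le> e"
      using has_sum_finite_approximation[OF parseval \<open>e > 0\<close>] by blast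
    define s where "s = (\<Sum>k\<in>F. (norm (\<phi> k x))\<^sup>2)"
    define P where "P = (\<lambda>y. \<Sum>k\<in>F. cnj (\<phi> k x) * \<phi> k y)"
    define Q where "Q = (\<lambda>y. (if y = x then 1 else 0) - P y)"
    have Px: "P x = complex_of_real s"
      unfolding s_def P_def of_real_sum by (simp add: complex_norm_square mult.commute del: of_real_power)
    have delta: "((\<lambda>y. if y = x then c else 0) has_sum c) UNIV" for c :: "'z::topological_comm_monoid_add"
      by (rule has_sum_finite_neutralI[of "{x}"]) auto
    \<comment> \<open>\<open>P\<close> and \<open>Q\<close> have equal modulus away from
      \<open>x\<close>. At \<open>x\<close> the squared modulus passes from that of \<open>s\<close>
      to that of \<open>1 - s\<close>, which explains the correction
      \<open>1 - 2 * s\<close>.\<close>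
    have "((\<lambda>y. (norm (P y))\<^sup>2 + (if y = x then 1 - 2 * s else 0)) has_sum (s + (1 - 2 * s))) UNIV"
      using orthonormal_l2_has_sum_combination[OF on F(1), of "\<lambda>k. cnj (\<phi> k x)"]
      by (intro has_sum_add delta) (simp add: P_def s_def)
    moreover have "(norm (P y))\<^sup>2 + (if y = x then 1 - 2 * s else 0) = (norm (Q y))\<^sup>2" for y
    proof (cases "y = x")
      case True
      have "norm (Q x) = \<bar>1 - s\<bar>"
        by (simp add: Q_def Px flip: norm_of_real[where 'a = complex])
      with True Px show ?thesis by (simp add: power2_eq_square algebra_simps)
    qed (simp add: Q_def)
    ultimately have Q: "((\<lambda>y. (norm (Q y))\<^sup>2) has_sum (1 - s)) UNIV"
      by simp
    have "((\<lambda>y. \<Sum>k\<in>F. \<phi> k x * (u y * cnj (\<phi> k y))) has_sum (\<Sum>k\<in>F. \<phi> k x * 0)) UNIV"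
      using has_sum_l2_inner[OF u, of "\<phi> _"] on F(1)
      by (intro has_sum_finite_sum has_sum_cmult_right) (auto simp: orth orthonormal_l2_def)
    moreover have "(\<Sum>k\<in>F. \<phi> k x * (u y * cnj (\<phi> k y))) = u y * cnj (P y)" for y
      by (simp add: P_def sum_distrib_left mult_ac)
    ultimately have "((\<lambda>y. u y * cnj (P y)) has_sum 0) UNIV"
      by simp
    then have "((\<lambda>y. (if y = x then u x else 0) + - (u y * cnj (P y))) has_sum (u x + - 0)) UNIV"
      by (intro has_sum_add delta has_sum_uminusI)
    moreover have "(if y = x then u x else 0) + - (u y * cnj (P y)) = u y * cnj (Q y)" for y
      by (simp add: Q_def algebra_simps)
    ultimately have uQ: "((\<lambda>y. u y * cnj (Q y)) has_sum u x) UNIV"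
      by simp
    have "((\<lambda>y. t * (norm (u y))\<^sup>2 + (norm (Q y))\<^sup>2 * (1 / t)) has_sum (t * U + (1 - s) * (1 / t))) UNIV"
      by (intro has_sum_add has_sum_cmult_right has_sum_cmult_left U Q)
    moreover have "norm (u y * cnj (Q y)) \<le> t * (norm (u y))\<^sup>2 + (norm (Q y))\<^sup>2 * (1 / t)" for y
    proof -
      have "0 \<le> (t * norm (u y) - norm (Q y))\<^sup>2 + t * norm (u y) * norm (Q y)"
        using \<open>t > 0\<close> by simp
      also have "\<dots> = t * (t * (norm (u y))\<^sup>2 + (norm (Q y))\<^sup>2 * (1 / t) - norm (u y) * norm (Q y))"
        using \<open>t > 0\<close> by (simp add: power2_eq_square field_simps)
      finally show ?thesis
        using \<open>t > 0\<close> by (simp add: norm_mult zero_le_mult_iff)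
    qed
    ultimately have "norm (u x) \<le> t * U + (1 - s) * (1 / t)"
      by (intro norm_infsum_le[OF uQ])
    also have "\<dots> \<le> t * U + e / t"
      using F(2) \<open>t > 0\<close> by (simp add: dist_real_def s_def[symmetric] divide_right_mono)
    finally show ?thesis .
  qed
  \<comment> \<open>With \<open>e = t * t\<close> both error terms are of order
    \<open>t\<close>.\<close>
  have "norm (u x) \<le> t * (U + 1)" if "t > 0" for t
    using bound[of t "t * t"] that by (simp add: algebra_simps)
  note small = this
  show ?thesis
  proof (rule ccontr)
    assume "u x \<noteq> 0"
    then have "norm (u x) \<le> norm (u x) / (2 * (U + 1)) * (U + 1)"
      using U0 by (intro small) auto
    also have "\<dots> = norm (u x) / 2"
      using U0 by (simp add: field_simps)
    finally show False
      using \<open>u x \<noteq> 0\<close> by simp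
  qed
qed

lemma in_l2_diff:
  assumes "in_l2 u" "in_l2 v"
  shows "in_l2 (\<lambda>x. u x - v x)"
  unfolding in_l2_def
proof (rule summable_on_comparison_test)
  show "(\<lambda>x. 2 * (norm (u x))\<^sup>2 + 2 * (norm (v x))\<^sup>2) summable_on UNIV"
    using assms unfolding in_l2_def by (intro summable_on_add summable_on_cmult_right)
  fix x
  have "(norm (u x - v x))\<^sup>2 \<le> (norm (u x) + norm (v x))\<^sup>2"
    by (intro power_mono norm_triangle_ineq4) auto
  also have "\<dots> \<le> 2 * (norm (u x))\<^sup>2 + 2 * (norm (v x))\<^sup>2"
    using sum_squares_bound[of "norm (u x)" "norm (v x)"] by (simp add: power2_sum)
  finally show "(norm (u x - v x))\<^sup>2 \<le> 2 * (norm (u x))\<^sup>2 + 2 * (norm (v x))\<^sup>2" .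
qed auto

lemma l2_inner_diff_left:
  assumes "in_l2 u" "in_l2 v" "in_l2 w"
  shows "l2_inner (\<lambda>x. u x - v x) w = l2_inner u w - l2_inner v w"
proof -
  have "((\<lambda>x. u x * cnj (w x) + - (v x * cnj (w x))) has_sum (l2_inner u w + - l2_inner v w)) UNIV"
    using assms by (intro has_sum_add has_sum_uminusI has_sum_l2_inner)
  then show ?thesis
    unfolding l2_inner_def[of "\<lambda>x. u x - v x"] by (intro infsumI) (simp add: algebra_simps)
qed

text \<open>The absolute summability of \<open>k \<mapsto> \<phi> k x\<close> makes the expansion
  \<open>\<Sum>k. cnj (\<phi> k x) \<cdot> \<phi> k\<close> of \<open>\<delta>\<^sub>x\<close> converge pointwise, so that the
  completeness of \<open>\<ell>\<^sup>2\<close> is not needed.\<close>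

lemma complete_imp_parseval:
  assumes on: "orthonormal_l2 \<phi>"
    and complete: "\<And>u. in_l2 u \<Longrightarrow> (\<And>k. l2_inner u (\<phi> k) = 0) \<Longrightarrow> u = (\<lambda>m. 0)"
    and summable: "(\<lambda>k. norm (\<phi> k x)) summable_on UNIV"
  shows "((\<lambda>k. (norm (\<phi> k x))\<^sup>2) has_sum 1) UNIV"
proof -
  define a where "a = (\<lambda>k. cnj (\<phi> k x))"
  define G where "G = (\<lambda>y. \<Sum>\<^sub>\<infinity>k. a k * \<phi> k y)"
  have l2: "in_l2 (\<phi> k)" for k
    using on by (simp add: orthonormal_l2_def)
  have inner: "l2_inner (\<phi> k) (\<phi> l) = (if k = l then 1 else 0)" for k l
    using on by (simp add: orthonormal_l2_def)
  have G: "((\<lambda>k. a k * \<phi> k y) has_sum G y) UNIV" for y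
  proof -
    have "(\<lambda>k. norm (a k * \<phi> k y)) summable_on UNIV"
    proof (rule summable_on_comparison_test[OF summable])
      show "norm (a k * \<phi> k y) \<le> norm (\<phi> k x)" for k
        using orthonormal_l2_norm_le_1[OF on, of k y] by (simp add: a_def norm_mult mult_left_le)
    qed auto
    then show ?thesis
      unfolding G_def by (rule has_sum_infsum[OF abs_summable_summable])
  qed
  \<comment> \<open>A Fatou argument: on finitely many sites pointwise convergence suffices, and by
    Bessel the partial sums have squared norm at most 1, a bound inherited by
    \<open>G\<close>.\<close>
  have "(\<Sum>y\<in>Y. (norm (G y))\<^sup>2) \<le> 1" if "finite Y" for Y
  proof (rule tendsto_upperbound)
    show "((\<lambda>F. \<Sum>y\<in>Y. (norm (\<Sum>k\<in>F. a k * \<phi> k y))\<^sup>2) \<longlongrightarrow> (\<Sum>y\<in>Y. (norm (G y))\<^sup>2))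
        (finite_subsets_at_top UNIV)"
      using G unfolding has_sum_def by (intro tendsto_sum tendsto_power tendsto_norm)
    show "\<forall>\<^sub>F F in finite_subsets_at_top UNIV. (\<Sum>y\<in>Y. (norm (\<Sum>k\<in>F. a k * \<phi> k y))\<^sup>2) \<le> 1"
    proof (rule eventually_finite_subsets_at_top_weakI)
      fix F :: "'a set" assume "finite F"
      have "(\<Sum>y\<in>Y. (norm (\<Sum>k\<in>F. a k * \<phi> k y))\<^sup>2) \<le> (\<Sum>k\<in>F. (norm (a k))\<^sup>2)"
        by (rule finite_sum_le_has_sum[OF orthonormal_l2_has_sum_combination[OF on \<open>finite F\<close>]])
          (use \<open>finite Y\<close> in auto)
      also have "\<dots> \<le> 1"
        using bessel[OF on \<open>finite F\<close>] by (simp add: a_def)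
      finally show "(\<Sum>y\<in>Y. (norm (\<Sum>k\<in>F. a k * \<phi> k y))\<^sup>2) \<le> 1" .
    qed
  qed simp
  then have G_l2: "in_l2 G"
    unfolding in_l2_def by (intro nonneg_bdd_above_summable_on) (auto intro!: bdd_aboveI2)
  define \<delta> where "\<delta> = (\<lambda>y. if y = x then 1 else 0 :: complex)"
  have \<delta>: "((\<lambda>y. \<delta> y * cnj (\<phi> l y)) has_sum cnj (\<phi> l x)) UNIV" for l
    by (rule has_sum_finite_neutralI[of "{x}"]) (auto simp: \<delta>_def)
  have \<delta>_l2: "in_l2 \<delta>"
    unfolding in_l2_def summable_on_def
    by (intro exI[of _ 1] has_sum_finite_neutralI[of "{x}"]) (auto simp: \<delta>_def)
  have G_inner: "l2_inner G (\<phi> l) = a l" for l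
  proof -
    \<comment> \<open>Both functions have norm 1, so the arithmetic-geometric inequality bounds the
      sum over sites by the modulus of \<open>a k\<close>. This is summable in \<open>k\<close>, and
      the two sums can be interchanged.\<close>
    have bound: "(\<Sum>\<^sub>\<infinity>y. norm (a k * \<phi> k y * cnj (\<phi> l y))) \<le> norm (\<phi> k x)"
      "(\<lambda>y. norm (a k * \<phi> k y * cnj (\<phi> l y))) summable_on UNIV" for k
    proof -
      have "(\<lambda>y. norm (a k) * norm (\<phi> k y * cnj (\<phi> l y))) summable_on UNIV"
        by (intro summable_on_cmult_right l2_prod_abs_summable l2)
      then show s: "(\<lambda>y. norm (a k * \<phi> k y * cnj (\<phi> l y))) summable_on UNIV"
        by (simp add: norm_mult mult_ac)
      have h: "((\<lambda>y. norm (a k) * (((norm (\<phi> k y))\<^sup>2 + (norm (\<phi> l y))\<^sup>2) * (1/2)))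
          has_sum (norm (a k) * ((1 + 1) * (1/2)))) UNIV"
        by (intro has_sum_cmult_right has_sum_cmult_left has_sum_add orthonormal_l2_has_sum_norm on)
      have "norm (a k * \<phi> k y * cnj (\<phi> l y))
          \<le> norm (a k) * (((norm (\<phi> k y))\<^sup>2 + (norm (\<phi> l y))\<^sup>2) * (1/2))" for y
        using sum_squares_bound[of "norm (\<phi> k y)" "norm (\<phi> l y)"]
        unfolding norm_mult mult.assoc by (intro mult_left_mono) auto
      then show "(\<Sum>\<^sub>\<infinity>y. norm (a k * \<phi> k y * cnj (\<phi> l y))) \<le> norm (\<phi> k x)"
        using has_sum_mono[OF has_sum_infsum[OF s] h] by (simp add: a_def)
    qed
    have "(\<lambda>z. norm (a (fst z) * \<phi> (fst z) (snd z) * cnj (\<phi> l (snd z)))) summable_on (UNIV \<times> UNIV)"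
      unfolding Infinite_Sum.abs_summable_on_Sigma_iff fst_conv snd_conv
    proof (intro conjI ballI)
      show "(\<lambda>k. norm (\<Sum>\<^sub>\<infinity>y. norm (a k * \<phi> k y * cnj (\<phi> l y)))) summable_on UNIV"
        using bound(1)
        by (intro summable_on_comparison_test[OF summable]) (auto simp: infsum_nonneg)
    qed (rule bound(2))
    from abs_summable_summable[OF this]
    have "(\<lambda>(k, y). a k * \<phi> k y * cnj (\<phi> l y)) summable_on (UNIV \<times> UNIV)"
      by (simp add: case_prod_unfold)
    have sum_y: "(\<Sum>\<^sub>\<infinity>y. a k * \<phi> k y * cnj (\<phi> l y)) = (if k = l then a l else 0)" for k
      using has_sum_cmult_right[OF has_sum_l2_inner[OF l2[of k] l2[of l]], of "a k"]
      by (intro infsumI) (auto simp: inner mult_ac)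
    have sum_k: "(\<Sum>\<^sub>\<infinity>k. a k * \<phi> k y * cnj (\<phi> l y)) = G y * cnj (\<phi> l y)" for y
      by (intro infsumI has_sum_cmult_left G)
    have "l2_inner G (\<phi> l) = (\<Sum>\<^sub>\<infinity>y. \<Sum>\<^sub>\<infinity>k. a k * \<phi> k y * cnj (\<phi> l y))"
      by (simp only: l2_inner_def sum_k)
    also have "\<dots> = (\<Sum>\<^sub>\<infinity>k. \<Sum>\<^sub>\<infinity>y. a k * \<phi> k y * cnj (\<phi> l y))"
      by (rule infsum_swap_banach[symmetric]) fact
    also have "\<dots> = (\<Sum>\<^sub>\<infinity>k. if k = l then a l else 0)"
      by (simp only: sum_y)
    also have "\<dots> = a l"
      by (intro infsumI has_sum_finite_neutralI[of "{l}"]) auto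
    finally show ?thesis .
  qed
  \<comment> \<open>\<open>G\<close> and \<open>\<delta>\<close> have the same coefficients, so
    completeness identifies them; their equality at \<open>x\<close> is Parseval's identity.\<close>
  have "(\<lambda>y. \<delta> y - G y) = (\<lambda>y. 0)"
  proof (rule complete)
    show "in_l2 (\<lambda>y. \<delta> y - G y)"
      by (intro in_l2_diff \<delta>_l2 G_l2)
    have "l2_inner \<delta> (\<phi> k) = a k" for k
      unfolding l2_inner_def a_def by (intro infsumI \<delta>)
    then show "l2_inner (\<lambda>y. \<delta> y - G y) (\<phi> k) = 0" for k
      by (simp add: l2_inner_diff_left \<delta>_l2 G_l2 l2 G_inner)
  qed
  from fun_cong[OF this, of x] have "G x = 1"
    by (simp add: \<delta>_def)
  moreover have "a k * \<phi> k x = complex_of_real ((norm (\<phi> k x))\<^sup>2)" for k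
    unfolding a_def by (subst complex_norm_square) simp
  ultimately have "((\<lambda>k. complex_of_real ((norm (\<phi> k x))\<^sup>2)) has_sum complex_of_real 1) UNIV"
    using G[of x] by simp
  then show ?thesis
    by (simp only: has_sum_of_real_iff)
qed

section \<open>Boundedly many functions per localization centre\<close>

text \<open>The box \<open>B\<close> is chosen from the squared envelope alone, which makes the
  count uniform in the centre. Counting the mass in the translated box by functions and by sites
  gives \<open>D = 2 * card B\<close>.\<close>

lemma localized_centers_finite_multiplicity:
  fixes \<phi> :: "'k \<Rightarrow> ('d::finite \<Rightarrow> int) \<Rightarrow> complex"
  assumes on: "orthonormal_l2 \<phi>" and "\<alpha> > 0"
    and bound: "\<And>k m. norm (\<phi> k m) \<le> C * exp (- \<alpha> * lat_norm (lat_diff m (c k)))"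
  shows "\<exists>D. \<forall>m. finite {k. c k = m} \<and> card {k. c k = m} \<le> D"
proof -
  define h where "h = (\<lambda>y::'d \<Rightarrow> int. C\<^sup>2 * exp (- (2 * \<alpha>) * lat_norm y))"
  have "h summable_on UNIV"
    unfolding h_def using \<open>\<alpha> > 0\<close> by (intro summable_on_cmult_right summable_exp_lat_norm) simp
  then obtain H where H: "(h has_sum H) UNIV"
    by (auto simp: summable_on_def)
  obtain B where B: "finite B" "dist (sum h B) H \<le> 1 / 2"
    using has_sum_finite_approximation[OF H, of "1/2"] by auto
  have mass: "1 / 2 \<le> (\<Sum>y\<in>B. (norm (\<phi> k (lat_add y (c k))))\<^sup>2)" for k
  proof -
    let ?f = "\<lambda>y. (norm (\<phi> k (lat_add y (c k))))\<^sup>2"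
    have f: "(?f has_sum 1) UNIV"
      using orthonormal_l2_has_sum_norm[OF on, of k]
        has_sum_reindex_bij_betw[OF bij_lat_add_right, of "\<lambda>x. (norm (\<phi> k x))\<^sup>2" "c k"] by simp
    have le: "?f y \<le> h y" for y
    proof -
      have "norm (\<phi> k (lat_add y (c k))) \<le> C * exp (- \<alpha> * lat_norm y)"
        using bound[of k "lat_add y (c k)"] by (simp add: lat_diff_def lat_add_def)
      then have "?f y \<le> (C * exp (- \<alpha> * lat_norm y))\<^sup>2"
        by (intro power_mono) auto
      also have "\<dots> = h y"
        by (simp add: h_def power_mult_distrib flip: exp_double)
      finally show ?thesis .
    qed
    \<comment> \<open>The defect \<open>h - ?f\<close> is nonnegative with total
      \<open>H - 1\<close>, so its part over \<open>B\<close> is no larger; since \<open>h\<close>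
      has all but 1/2 of its total on \<open>B\<close>, at least 1/2 remains for \<open>?f\<close>
      there.\<close>
    have "(\<Sum>y\<in>B. h y + - ?f y) \<le> H + - 1"
      using le \<open>finite B\<close>
      by (intro finite_sum_le_has_sum[OF has_sum_add[OF H has_sum_uminusI[OF f]]]) auto
    moreover have "H - sum h B \<le> 1 / 2"
      using B(2) unfolding dist_real_def by linarith
    ultimately show ?thesis
      by (simp add: sum_subtractf)
  qed
  \<comment> \<open>Arbitrary finite subsets are counted because finiteness of the whole fibre is
    part of the claim.\<close>
  have "card F \<le> 2 * card B" if F: "F \<subseteq> {k. c k = m}" "finite F" for F m
  proof -
    have "real (card F) * (1 / 2) = (\<Sum>k\<in>F. 1 / 2)"
      by simp
    also have "\<dots> \<le> (\<Sum>k\<in>F. \<Sum>y\<in>B. (norm (\<phi> k (lat_add y m)))\<^sup>2)"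
    proof (rule sum_mono)
      fix k assume "k \<in> F"
      then have "c k = m"
        using F by blast
      then show "1 / 2 \<le> (\<Sum>y\<in>B. (norm (\<phi> k (lat_add y m)))\<^sup>2)"
        using mass[of k] by simp
    qed
    also have "\<dots> = (\<Sum>y\<in>B. \<Sum>k\<in>F. (norm (\<phi> k (lat_add y m)))\<^sup>2)"
      by (rule sum.swap)
    also have "\<dots> \<le> (\<Sum>y\<in>B. 1)"
      by (intro sum_mono bessel[OF on \<open>finite F\<close>])
    finally show ?thesis
      by simp
  qed
  then have "finite {k. c k = m} \<and> card {k. c k = m} \<le> 2 * card B" for m
    by (rule finite_if_finite_subsets_card_bdd)
  then show ?thesis
    by (intro exI[of _ "2 * card B"] allI)
qed

section \<open>Localized systems indexed by centres\<close>

text \<open>The first component of \<open>p\<close> is a centre and the second a slot. Slots range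
  over all naturals to keep the index type fixed; the cutoff at \<open>D\<close> makes the envelope
  summable over \<open>p\<close>.\<close>

definition envelope :: "real \<Rightarrow> real \<Rightarrow> nat \<Rightarrow> ('d::finite \<Rightarrow> int) \<times> nat \<Rightarrow> ('d \<Rightarrow> int) \<Rightarrow> real" where
  "envelope \<alpha> C D p x = (if snd p < D then C * exp (- \<alpha> * lat_norm (lat_diff x (fst p))) else 0)"

text \<open>\<open>\<Phi> (m, i)\<close> is the \<open>i\<close>-th eigenfunction centred at \<open>m\<close>; unused slots hold the zero function.
  The second and third conditions are the eigenvalue equation for a real eigenvalue, and the last
  one is Parseval's identity for the unit vectors of the lattice.\<close>

definition localized_system ::
  "(('d::finite \<Rightarrow> int) \<Rightarrow> real) \<Rightarrow> real \<Rightarrow> real \<Rightarrow> nat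
    \<Rightarrow> (('d \<Rightarrow> int) \<times> nat \<Rightarrow> ('d \<Rightarrow> int) \<Rightarrow> complex) \<Rightarrow> bool" where
  "localized_system V \<alpha> C D \<Phi> \<longleftrightarrow>
     (\<forall>p x. norm (\<Phi> p x) \<le> envelope \<alpha> C D p x) \<and>
     (\<forall>p x y. schr_op V (\<Phi> p) x * \<Phi> p y = schr_op V (\<Phi> p) y * \<Phi> p x) \<and>
     (\<forall>p x. Im (schr_op V (\<Phi> p) x * cnj (\<Phi> p x)) = 0) \<and>
     (\<forall>p. l2_inner (\<Phi> p) (\<Phi> p) \<in> {0, 1}) \<and>
     (\<forall>p q. p \<noteq> q \<longrightarrow> l2_inner (\<Phi> p) (\<Phi> q) = 0) \<and>
     (\<forall>x. (\<Sum>\<^sub>\<infinity>p. (norm (\<Phi> p x))\<^sup>2) = 1)"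

lemma localized_systemD:
  assumes "localized_system V \<alpha> C D \<Phi>"
  shows "norm (\<Phi> p x) \<le> envelope \<alpha> C D p x"
    and "schr_op V (\<Phi> p) x * \<Phi> p y = schr_op V (\<Phi> p) y * \<Phi> p x"
    and "Im (schr_op V (\<Phi> p) x * cnj (\<Phi> p x)) = 0"
    and "l2_inner (\<Phi> p) (\<Phi> p) = 0 \<or> l2_inner (\<Phi> p) (\<Phi> p) = 1"
    and "p \<noteq> q \<Longrightarrow> l2_inner (\<Phi> p) (\<Phi> q) = 0"
    and "(\<Sum>\<^sub>\<infinity>p. (norm (\<Phi> p x))\<^sup>2) = 1"
  using assms unfolding localized_system_def by blast+

lemma envelope_nonneg: "0 \<le> C \<Longrightarrow> 0 \<le> envelope \<alpha> C D p x"
  by (simp add: envelope_def)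

lemma envelope_le: "0 \<le> C \<Longrightarrow> 0 \<le> \<alpha> \<Longrightarrow> envelope \<alpha> C D p x \<le> C"
  by (simp add: envelope_def mult_left_le mult_nonneg_nonneg)

lemma summable_envelope_sites:
  fixes p :: "('d::finite \<Rightarrow> int) \<times> nat"
  assumes "\<alpha> > 0"
  shows "(\<lambda>x. envelope \<alpha> C D p x) summable_on UNIV"
  unfolding envelope_def
  using summable_on_cmult_right[OF summable_exp_lat_diff[OF assms, of "fst p"], of C]
  by (cases "snd p < D") simp_all

lemma summable_envelope_centers:
  fixes x :: "'d::finite \<Rightarrow> int"
  assumes "\<alpha> > 0"
  shows "(\<lambda>p. envelope \<alpha> C D p x) summable_on UNIV"
proof -
  let ?w = "\<lambda>m. exp (- \<alpha> * lat_norm (lat_diff x m))"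
  have "(\<lambda>p. if snd p < D then ?w (fst p) else 0) summable_on (UNIV \<times> UNIV)"
  proof (rule summable_on_SigmaI)
    show "((\<lambda>i. if snd (m, i) < D then ?w (fst (m, i)) else 0) has_sum real D * ?w m) UNIV" for m
      by (rule has_sum_finite_neutralI[of "{..<D}"]) auto
    show "(\<lambda>m. real D * ?w m) summable_on UNIV"
      using summable_exp_lat_diff[OF assms, of x]
      by (subst lat_norm_diff_commute) (rule summable_on_cmult_right)
  qed auto
  then have "(\<lambda>p. C * (if snd p < D then ?w (fst p) else 0)) summable_on UNIV"
    by (intro summable_on_cmult_right) simp
  then show ?thesis
    by (simp add: envelope_def if_distrib[of "\<lambda>z. C * z"] cong: if_cong)
qed

text \<open>One factor is absorbed into the constant \<open>C\<close>, the other keeps its decay.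
  This provides the summable majorant for squared norms and inner products, over sites as well as
  over centres.\<close>

lemma envelope_mult_le:
  assumes "0 \<le> C" "0 \<le> \<alpha>" "norm a \<le> envelope \<alpha> C D p x" "norm b \<le> envelope \<alpha> C D q y"
  shows "norm (a * b :: complex) \<le> C * envelope \<alpha> C D p x"
proof -
  have "norm a * norm b \<le> envelope \<alpha> C D p x * C"
    using assms envelope_le[of C \<alpha> D q y] envelope_nonneg[of C \<alpha> D p x]
    by (intro mult_mono) auto
  then show ?thesis
    by (simp add: norm_mult mult.commute)
qed

lemma envelope_imp_in_l2:
  assumes "0 \<le> C" "0 < \<alpha>" "\<And>x. norm (u x) \<le> envelope \<alpha> C D p x"
  shows "in_l2 u"
  unfolding in_l2_def
proof (rule summable_on_comparison_test)
  show "(\<lambda>x. C * envelope \<alpha> C D p x) summable_on UNIV"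
    using assms by (intro summable_on_cmult_right summable_envelope_sites)
  show "(norm (u x))\<^sup>2 \<le> C * envelope \<alpha> C D p x" for x
    using envelope_mult_le[of C \<alpha> "u x" D p x "u x" p x] assms
    by (simp add: norm_mult power2_eq_square)
qed auto

section \<open>Passage between localized systems and eigenbases\<close>

lemma countable_lattice: "countable (UNIV :: ('d::finite \<Rightarrow> int) set)"
proof -
  have "countable (PiE (UNIV :: 'd set) (\<lambda>_. UNIV :: int set))"
    by (rule countable_PiE) auto
  moreover have "PiE (UNIV :: 'd set) (\<lambda>_. UNIV :: int set) = UNIV"
    by (auto simp: PiE_def)
  ultimately show ?thesis
    by simp
qed

lemma infinite_lattice: "infinite (UNIV :: ('d::finite \<Rightarrow> int) set)"
proof
  assume "finite (UNIV :: ('d \<Rightarrow> int) set)"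
  then have "finite (range (\<lambda>k::int. (\<lambda>_::'d. k)))"
    by (rule finite_subset[OF subset_UNIV])
  then have "finite (UNIV :: int set)"
    by (rule finite_imageD) (auto simp: inj_on_def fun_eq_iff)
  then show False by simp
qed

text \<open>The eigenvalue is the quotient of \<open>schr_op V u\<close> by \<open>u\<close> at
  \<open>x0\<close>. Multiplying numerator and denominator by \<open>cnj (u x0)\<close> shows that
  it is real, and the cross relation carries it to every site.\<close>

lemma cross_eigen_imp_eigenfunction:
  assumes "in_l2 u" "u x0 \<noteq> 0"
    and cross: "\<And>x y. schr_op V u x * u y = schr_op V u y * u x"
    and real: "Im (schr_op V u x0 * cnj (u x0)) = 0"
  shows "is_eigenfunction V u"
proof -
  define E where "E = Re (schr_op V u x0 / u x0)"
  have "schr_op V u x0 / u x0 = schr_op V u x0 * cnj (u x0) / complex_of_real ((norm (u x0))\<^sup>2)"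
    using \<open>u x0 \<noteq> 0\<close> by (subst complex_norm_square) (simp add: field_simps)
  then have "Im (schr_op V u x0 / u x0) = 0"
    using real by (simp only: Im_divide_of_real)
  then have "complex_of_real E = schr_op V u x0 / u x0"
    by (simp add: E_def complex_eq_iff)
  then have E: "schr_op V u x0 = complex_of_real E * u x0"
    using \<open>u x0 \<noteq> 0\<close> by simp
  have "schr_op V u x = complex_of_real E * u x" for x
  proof -
    have "u x0 * schr_op V u x = u x0 * (complex_of_real E * u x)"
      using cross[of x x0] by (simp add: E mult_ac)
    then show ?thesis
      using \<open>u x0 \<noteq> 0\<close> by simp
  qed
  then show ?thesis
    using assms(1,2) unfolding is_eigenfunction_def by blast
qed

lemma eigenfunction_imp_cross:
  assumes "is_eigenfunction V u"
  shows "schr_op V u x * u y = schr_op V u y * u x" "Im (schr_op V u x * cnj (u x)) = 0"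
proof -
  obtain E :: real where "\<And>n. schr_op V u n = complex_of_real E * u n"
    using assms unfolding is_eigenfunction_def by blast
  then show "schr_op V u x * u y = schr_op V u y * u x" "Im (schr_op V u x * cnj (u x)) = 0"
    by (auto simp: mult.assoc simp flip: complex_norm_square)
qed

lemma localized_system_in_l2:
  assumes "0 < C" "0 < \<alpha>" "localized_system V \<alpha> C D \<Phi>"
  shows "in_l2 (\<Phi> p)"
  using assms by (intro envelope_imp_in_l2[OF _ _ localized_systemD(1)]) auto

lemma localized_system_zero:
  assumes "0 < C" "0 < \<alpha>" and \<Phi>: "localized_system V \<alpha> C D \<Phi>"
    and "l2_inner (\<Phi> p) (\<Phi> p) \<noteq> 1"
  shows "\<Phi> p x = 0"
proof -
  have "l2_inner (\<Phi> p) (\<Phi> p) = 0"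
    using localized_systemD(4)[OF \<Phi>] assms(4) by blast
  then have "((\<lambda>x. (norm (\<Phi> p x))\<^sup>2) has_sum 0) UNIV"
    using has_sum_l2_norm[OF localized_system_in_l2[OF assms(1-3)], of p] by simp
  then have "(norm (\<Phi> p x))\<^sup>2 = 0"
    by (rule nonneg_has_sum_le_0D) auto
  then show ?thesis by simp
qed

text \<open>A trace count: every site carries total mass 1 and every function has mass 1, so
  \<open>n\<close> functions cannot fill \<open>n + 1\<close> sites. This is needed because the
  eigenbasis must be indexed by all of \<open>nat\<close>.\<close>

lemma localized_system_infinite_support:
  fixes \<Phi> :: "('d::finite \<Rightarrow> int) \<times> nat \<Rightarrow> ('d \<Rightarrow> int) \<Rightarrow> complex"
  assumes "0 < C" "0 < \<alpha>" and \<Phi>: "localized_system V \<alpha> C D \<Phi>"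
  shows "infinite {p. l2_inner (\<Phi> p) (\<Phi> p) = 1}"
proof
  let ?P = "{p. l2_inner (\<Phi> p) (\<Phi> p) = 1}"
  assume fin: "finite ?P"
  note l2 = localized_system_in_l2[OF assms]
  have zero: "\<Phi> p x = 0" if "p \<notin> ?P" for p x
    using that localized_system_zero[OF assms] by simp
  obtain Y :: "('d \<Rightarrow> int) set" where Y: "finite Y" "card Y = Suc (card ?P)"
    using infinite_arbitrarily_large[OF infinite_lattice] by blast
  have "(\<Sum>p\<in>?P. (norm (\<Phi> p x))\<^sup>2) = 1" for x
  proof -
    have "(\<Sum>\<^sub>\<infinity>p. (norm (\<Phi> p x))\<^sup>2) = (\<Sum>p\<in>?P. (norm (\<Phi> p x))\<^sup>2)"
      using zero fin by (intro infsumI has_sum_finite_neutralI) auto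
    then show ?thesis
      by (simp add: localized_systemD(6)[OF \<Phi>])
  qed
  then have "real (card Y) = (\<Sum>x\<in>Y. \<Sum>p\<in>?P. (norm (\<Phi> p x))\<^sup>2)"
    by simp
  also have "\<dots> = (\<Sum>p\<in>?P. \<Sum>x\<in>Y. (norm (\<Phi> p x))\<^sup>2)"
    by (rule sum.swap)
  also have "\<dots> \<le> (\<Sum>p\<in>?P. 1)"
  proof (rule sum_mono)
    fix p assume "p \<in> ?P"
    then have "((\<lambda>x. (norm (\<Phi> p x))\<^sup>2) has_sum 1) UNIV"
      using has_sum_l2_norm[OF l2[of p]] by simp
    then show "(\<Sum>x\<in>Y. (norm (\<Phi> p x))\<^sup>2) \<le> 1"
      using Y(1) by (intro finite_sum_le_has_sum) auto
  qed
  finally show False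
    using Y(2) by simp
qed

lemma localized_system_imp_ULE_rate:
  fixes \<Phi> :: "('d::finite \<Rightarrow> int) \<times> nat \<Rightarrow> ('d \<Rightarrow> int) \<Rightarrow> complex"
  assumes "0 < C" "0 < \<alpha>" and \<Phi>: "localized_system V \<alpha> C D \<Phi>"
  shows "ULE_rate V \<alpha>"
proof -
  let ?P = "{p. l2_inner (\<Phi> p) (\<Phi> p) = 1}"
  define e where "e = from_nat_into ?P"
  note l2 = localized_system_in_l2[OF assms]
  have zero: "\<Phi> p x = 0" if "p \<notin> ?P" for p x
    using that localized_system_zero[OF assms] by simp
  have "countable (UNIV \<times> UNIV :: (('d \<Rightarrow> int) \<times> nat) set)"
    by (intro countable_SIGMA countable_lattice) auto
  then have "countable ?P"
    using countable_subset by auto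
  then have e: "bij_betw e UNIV ?P"
    unfolding e_def using localized_system_infinite_support[OF assms] by (rule bij_betw_from_nat_into)
  then have eP: "e k \<in> ?P" for k
    using bij_betwE by blast
  have on: "orthonormal_l2 (\<lambda>k. \<Phi> (e k))"
    unfolding orthonormal_l2_def
  proof (intro conjI allI)
    fix k l
    show "l2_inner (\<Phi> (e k)) (\<Phi> (e l)) = (if k = l then 1 else 0)"
    proof (cases "k = l")
      case False
      then have "e k \<noteq> e l"
        using e by (auto simp: bij_betw_def inj_eq)
      with False show ?thesis
        by (simp add: localized_systemD(5)[OF \<Phi>])
    qed (use eP in auto)
  qed (rule l2)
  have parseval: "((\<lambda>k. (norm (\<Phi> (e k) x))\<^sup>2) has_sum 1) UNIV" for x
  proof -
    \<comment> \<open>An infinite sum that does not exist has the default value 0, so the value 1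
      already forces summability.\<close>
    have "((\<lambda>p. (norm (\<Phi> p x))\<^sup>2) has_sum 1) UNIV"
      using localized_systemD(6)[OF \<Phi>, of x] infsum_not_exists[of "\<lambda>p. (norm (\<Phi> p x))\<^sup>2" UNIV]
      by (auto simp: has_sum_iff)
    then have "((\<lambda>p. (norm (\<Phi> p x))\<^sup>2) has_sum 1) ?P"
      using zero by (subst has_sum_cong_neutral[where T = UNIV]) auto
    then show ?thesis
      using has_sum_reindex_bij_betw[OF e, of "\<lambda>p. (norm (\<Phi> p x))\<^sup>2"] by simp
  qed
  have eigen: "is_eigenfunction V (\<Phi> (e k))" for k
  proof -
    have "\<exists>x0. \<Phi> (e k) x0 \<noteq> 0"
    proof (rule ccontr)
      assume "\<nexists>x0. \<Phi> (e k) x0 \<noteq> 0"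
      then have "l2_inner (\<Phi> (e k)) (\<Phi> (e k)) = 0"
        by (simp add: l2_inner_def)
      then show False
        using eP[of k] by simp
    qed
    then obtain x0 where "\<Phi> (e k) x0 \<noteq> 0" ..
    then show ?thesis
      by (rule cross_eigen_imp_eigenfunction[OF l2]) (rule localized_systemD[OF \<Phi>])+
  qed
  have "complete_ON_eigenbasis V (\<lambda>k. \<Phi> (e k))"
    unfolding complete_ON_eigenbasis_def
    using eigen on parseval_imp_complete[OF on parseval]
    by (auto simp: orthonormal_l2_def fun_eq_iff)
  moreover have "norm (\<Phi> (e k) x) \<le> C * exp (- \<alpha> * lat_norm (lat_diff x (fst (e k))))" for k x
  proof -
    have "norm (\<Phi> (e k) x) \<le> envelope \<alpha> C D (e k) x"
      by (rule localized_systemD(1)[OF \<Phi>])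
    also have "\<dots> \<le> C * exp (- \<alpha> * lat_norm (lat_diff x (fst (e k))))"
      using \<open>0 < C\<close> by (simp add: envelope_def)
    finally show ?thesis .
  qed
  ultimately show ?thesis
    unfolding ULE_rate_def using \<open>0 < C\<close>
    by (intro exI[of _ C] conjI exI[of _ "\<lambda>k. \<Phi> (e k)"] exI[of _ "\<lambda>k. fst (e k)"]) auto
qed

lemma eigenbasis_imp_localized_system:
  fixes \<phi> :: "nat \<Rightarrow> ('d::finite \<Rightarrow> int) \<Rightarrow> complex"
  assumes "0 < C" "0 < \<alpha>" and basis: "complete_ON_eigenbasis V \<phi>"
    and bound: "\<And>k m. norm (\<phi> k m) \<le> C * exp (- \<alpha> * lat_norm (lat_diff m (c k)))"
  obtains D \<Phi> where "localized_system V \<alpha> C D \<Phi>"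
proof -
  have eigen: "is_eigenfunction V (\<phi> k)" for k
    using basis by (simp add: complete_ON_eigenbasis_def)
  have on: "orthonormal_l2 \<phi>"
    using basis by (simp add: complete_ON_eigenbasis_def orthonormal_l2_def is_eigenfunction_def)
  have complete: "u = (\<lambda>m. 0)" if "in_l2 u" "\<And>k. l2_inner u (\<phi> k) = 0" for u
    using basis that unfolding complete_ON_eigenbasis_def by blast
  obtain D where D: "\<And>m. finite {k. c k = m}" "\<And>m. card {k. c k = m} \<le> D"
    using localized_centers_finite_multiplicity[OF on \<open>0 < \<alpha>\<close> bound] by metis
  \<comment> \<open>The slot \<open>g k\<close> is the number of earlier functions with the same
    centre; this makes \<open>\<iota>\<close> injective and keeps every slot below
    \<open>D\<close>.\<close>
  define g where "g = (\<lambda>k. card {j. c j = c k \<and> j < k})"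
  have g_less: "g k < card {j. c j = c k}" for k
    unfolding g_def by (intro psubset_card_mono D(1)) auto
  define \<iota> where "\<iota> = (\<lambda>k. (c k, g k))"
  have strict: "g k < g l" if "c k = c l" "k < l" for k l
    unfolding g_def using that by (intro psubset_card_mono) auto
  have inj: "inj \<iota>"
  proof (rule injI)
    fix k l assume "\<iota> k = \<iota> l"
    then show "k = l"
      using strict[of k l] strict[of l k] by (cases k l rule: linorder_cases) (auto simp: \<iota>_def)
  qed
  have bound': "norm (\<phi> k x) \<le> envelope \<alpha> C D (\<iota> k) x" for k x
    using bound[of k x] g_less[of k] D(2)[of "c k"] by (simp add: \<iota>_def envelope_def)
  \<comment> \<open>This is the summability that Parseval's identity requires; it comes from the
    envelope, summable over all pairs of centre and slot, by injectivity of
    \<open>\<iota>\<close>.\<close>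
  have summable: "(\<lambda>k. norm (\<phi> k x)) summable_on UNIV" for x
  proof (rule summable_on_comparison_test)
    have "(\<lambda>p. envelope \<alpha> C D p x) summable_on (range \<iota>)"
      using summable_envelope_centers[OF \<open>0 < \<alpha>\<close>] by (rule summable_on_subset_banach) simp
    then show "(\<lambda>k. envelope \<alpha> C D (\<iota> k) x) summable_on UNIV"
      by (simp add: summable_on_reindex[OF inj] o_def)
  qed (use bound' in auto)
  define \<Phi> where "\<Phi> = (\<lambda>p. if p \<in> range \<iota> then \<phi> (inv \<iota> p) else (\<lambda>x. 0))"
  have \<Phi>_\<iota>: "\<Phi> (\<iota> k) = \<phi> k" for k
    by (simp add: \<Phi>_def inj)
  have \<Phi>_0: "\<Phi> p = (\<lambda>x. 0)" if "p \<notin> range \<iota>" for p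
    using that by (simp add: \<Phi>_def)
  have cases_p: "(\<exists>k. p = \<iota> k) \<or> \<Phi> p = (\<lambda>x. 0)" for p
    using \<Phi>_0 by blast
  have "localized_system V \<alpha> C D \<Phi>"
    unfolding localized_system_def
  proof (intro conjI allI impI)
    fix p q x y
    show "norm (\<Phi> p x) \<le> envelope \<alpha> C D p x"
      using cases_p[of p] bound' \<open>0 < C\<close> by (auto simp: \<Phi>_\<iota> envelope_nonneg)
    show "schr_op V (\<Phi> p) x * \<Phi> p y = schr_op V (\<Phi> p) y * \<Phi> p x"
      using cases_p[of p] eigenfunction_imp_cross(1)[OF eigen] by (auto simp: \<Phi>_\<iota>)
    show "Im (schr_op V (\<Phi> p) x * cnj (\<Phi> p x)) = 0"
      using cases_p[of p] eigenfunction_imp_cross(2)[OF eigen] by (auto simp: \<Phi>_\<iota>)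
    show "l2_inner (\<Phi> p) (\<Phi> p) \<in> {0, 1}"
      using cases_p[of p] on by (auto simp: \<Phi>_\<iota> orthonormal_l2_def l2_inner_def)
    show "l2_inner (\<Phi> p) (\<Phi> q) = 0" if "p \<noteq> q"
      using cases_p[of p] cases_p[of q] on that
      by (auto simp: \<Phi>_\<iota> orthonormal_l2_def) (auto simp: l2_inner_def)
    have "((\<lambda>k. (norm (\<Phi> (\<iota> k) x))\<^sup>2) has_sum 1) UNIV"
      unfolding \<Phi>_\<iota> by (rule complete_imp_parseval[OF on complete summable])
    then have "((\<lambda>p. (norm (\<Phi> p x))\<^sup>2) has_sum 1) (range \<iota>)"
      by (simp add: has_sum_reindex[OF inj] o_def)
    then have "((\<lambda>p. (norm (\<Phi> p x))\<^sup>2) has_sum 1) UNIV"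
      by (subst has_sum_cong_neutral[where T = "range \<iota>"]) (auto simp: \<Phi>_0)
    then show "(\<Sum>\<^sub>\<infinity>p. (norm (\<Phi> p x))\<^sup>2) = 1"
      by (rule infsumI)
  qed
  then show ?thesis
    using that by blast
qed

section \<open>Closedness and invariance\<close>

text \<open>The Weierstrass M-test: the majorant \<open>B\<close> makes the finite partial sums
  converge uniformly on \<open>S\<close>.\<close>

lemma continuous_on_infsum:
  fixes f :: "'i \<Rightarrow> 'b::topological_space \<Rightarrow> 'c::banach"
  assumes "\<And>i. continuous_on S (f i)" "\<And>i z. z \<in> S \<Longrightarrow> norm (f i z) \<le> B i" "B summable_on UNIV"
  shows "continuous_on S (\<lambda>z. \<Sum>\<^sub>\<infinity>i. f i z)"
proof (rule uniform_limit_theorem)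
  show "uniform_limit S (\<lambda>F z. \<Sum>i\<in>F. f i z) (\<lambda>z. \<Sum>\<^sub>\<infinity>i. f i z) (finite_subsets_at_top UNIV)"
    by (rule Weierstrass_m_test_general[OF _ assms(3)]) (use assms(2) in auto)
  show "\<forall>\<^sub>F F in finite_subsets_at_top UNIV. continuous_on S (\<lambda>z. \<Sum>i\<in>F. f i z)"
    by (intro always_eventually allI continuous_on_sum assms(1))
qed simp

text \<open>This is the tube lemma: projection along a compact factor is a closed map.\<close>

lemma closed_fst_image:
  fixes Z :: "('a::topological_space \<times> 'b::topological_space) set"
  assumes "compact K" "closed Z" "Z \<subseteq> UNIV \<times> K"
  shows "closed (fst ` Z)"
proof -
  have "compact_space (top_of_set K)"
    using assms(1) by (simp add: compact_space_subtopology)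
  then have "closed_map (prod_topology euclidean (top_of_set K)) euclidean (fst :: 'a \<times> 'b \<Rightarrow> 'a)"
    by (rule closed_map_fst)
  moreover have "prod_topology euclidean (top_of_set K) = top_of_set (UNIV \<times> K :: ('a \<times> 'b) set)"
    using prod_topology_subtopology_eu[of "UNIV :: 'a set" K] by simp
  moreover have "closedin (top_of_set (UNIV \<times> K)) Z"
    using assms(2,3) by (simp add: closed_subset)
  ultimately show ?thesis
    unfolding closed_map_def by (metis closed_closedin)
qed

text \<open>Tychonoff's theorem applied twice, to a product of products of closed discs.\<close>

lemma compact_norm_envelope:
  fixes r :: "'i \<Rightarrow> 'j \<Rightarrow> real"
  shows "compact {\<Phi>. \<forall>p x. norm (\<Phi> p x :: complex) \<le> r p x}"
proof -
  have compact_Pi: "compact (PiE UNIV A)" if "\<And>i. compact (A i)"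
    for A :: "'k \<Rightarrow> 'z::topological_space set"
    using that compactin_PiE[of "\<lambda>_. euclidean" UNIV A] by (simp add: euclidean_product_topology)
  have "compact (PiE UNIV (\<lambda>p. PiE UNIV (\<lambda>x. cball (0::complex) (r p x))))"
    by (intro compact_Pi compact_cball)
  also have "PiE UNIV (\<lambda>p. PiE UNIV (\<lambda>x. cball (0::complex) (r p x))) =
      {\<Phi>. \<forall>p x. norm (\<Phi> p x) \<le> r p x}"
    by (auto simp: PiE_def Pi_def)
  finally show ?thesis .
qed

text \<open>The eigenvalues may be unbounded, so they cannot be parameters ranging over a compact set;
  this is why \<^const>\<open>localized_system\<close> expresses the eigenvalue equation without them.\<close>

lemma closed_localized_system:
  fixes V :: "'a::topological_space \<Rightarrow> ('d::finite \<Rightarrow> int) \<Rightarrow> real"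
  assumes V: "\<And>n. continuous_on UNIV (\<lambda>\<omega>. V \<omega> n)" and "0 < C" "0 < \<alpha>"
  shows "closed {\<omega>. \<exists>\<Phi>. localized_system (V \<omega>) \<alpha> C D \<Phi>}"
proof -
  define K where "K = {\<Phi> :: ('d \<Rightarrow> int) \<times> nat \<Rightarrow> ('d \<Rightarrow> int) \<Rightarrow> complex.
    \<forall>p x. norm (\<Phi> p x) \<le> envelope \<alpha> C D p x}"
  define S where "S = (UNIV :: 'a set) \<times> K"
  have "compact K"
    unfolding K_def by (rule compact_norm_envelope)
  have bound: "norm (snd z p x) \<le> envelope \<alpha> C D p x" if "z \<in> S" for z p x
    using that by (simp add: S_def K_def mem_Times_iff del: split_paired_All)
  have \<Phi>: "continuous_on A (\<lambda>z. snd z p x)" for p x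
    and A :: "('a \<times> (('d \<Rightarrow> int) \<times> nat \<Rightarrow> ('d \<Rightarrow> int) \<Rightarrow> complex)) set"
    using continuous_on_product_then_coordinatewise[OF
        continuous_on_product_then_coordinatewise[OF continuous_on_snd[OF continuous_on_id]]] .
  have "closed K"
  proof -
    have "continuous_on UNIV (\<lambda>\<Phi>::('d \<Rightarrow> int) \<times> nat \<Rightarrow> ('d \<Rightarrow> int) \<Rightarrow> complex. \<Phi> p x)" for p x
      using continuous_on_product_then_coordinatewise[OF
          continuous_on_product_then_coordinatewise[OF continuous_on_id]] .
    then show ?thesis
      unfolding K_def by (intro closed_Collect_all closed_Collect_le continuous_on_norm continuous_on_const)
  qed
  then have "closed S"
    unfolding S_def by (intro closed_Times) auto
  have pre: "closed {z \<in> S. h z \<in> A}" if "continuous_on S h" "closed A"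
    for h :: "_ \<Rightarrow> 'z::topological_space" and A
    using continuous_closed_preimage[OF that(1) \<open>closed S\<close> that(2)] by (simp add: vimage_def Int_def)
  have all: "closed {z \<in> S. \<forall>i. P i z}" if "\<And>i. closed {z \<in> S. P i z}" for P :: "'i \<Rightarrow> _ \<Rightarrow> bool"
  proof -
    have "{z \<in> S. \<forall>i. P i z} = (\<Inter>i. {z \<in> S. P i z})"
      by auto
    then show ?thesis
      using that by auto
  qed
  have conj: "closed {z \<in> S. P z \<and> Q z}" if "closed {z \<in> S. P z}" "closed {z \<in> S. Q z}" for P Q
  proof -
    have "{z \<in> S. P z \<and> Q z} = {z \<in> S. P z} \<inter> {z \<in> S. Q z}"
      by auto
    then show ?thesis
      using that by auto
  qed
  have H: "continuous_on S (\<lambda>z. schr_op (V (fst z)) (snd z p) x)" for p x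
    unfolding schr_op_def
    by (intro continuous_intros \<Phi> continuous_on_compose2[OF V]) auto
  have inner: "continuous_on S (\<lambda>z. l2_inner (snd z p) (snd z q))" for p q
    unfolding l2_inner_def
  proof (rule continuous_on_infsum)
    show "(\<lambda>x. C * envelope \<alpha> C D p x) summable_on UNIV"
      using \<open>0 < \<alpha>\<close> by (intro summable_on_cmult_right summable_envelope_sites)
    show "norm (snd z p x * cnj (snd z q x)) \<le> C * envelope \<alpha> C D p x" if "z \<in> S" for x z
      using bound[OF that] \<open>0 < C\<close> \<open>0 < \<alpha>\<close> by (intro envelope_mult_le[where q = q and y = x]) auto
  qed (intro continuous_intros \<Phi>)
  have parseval: "continuous_on S (\<lambda>z. \<Sum>\<^sub>\<infinity>p. (norm (snd z p x))\<^sup>2)" for x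
  proof (rule continuous_on_infsum)
    show "(\<lambda>p. C * envelope \<alpha> C D p x) summable_on UNIV"
      using \<open>0 < \<alpha>\<close> by (intro summable_on_cmult_right summable_envelope_centers)
    show "norm ((norm (snd z p x))\<^sup>2) \<le> C * envelope \<alpha> C D p x" if "z \<in> S" for z p
      using envelope_mult_le[OF _ _ bound[OF that, of p x] bound[OF that, of p x]] \<open>0 < C\<close> \<open>0 < \<alpha>\<close>
      by (simp add: norm_mult power2_eq_square)
  qed (intro continuous_intros \<Phi>)
  \<comment> \<open>Each clause says that a function continuous on \<open>S\<close> takes values in
    a closed set, the form to which \<open>pre\<close> applies. The target \<open>UNIV\<close> for
    \<open>p = q\<close> encodes the premise \<open>p \<noteq> q\<close> of orthogonality.\<close>
  define Z where "Z = {z \<in> S.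
     (\<forall>p x y. schr_op (V (fst z)) (snd z p) x * snd z p y - schr_op (V (fst z)) (snd z p) y * snd z p x \<in> {0}) \<and>
     (\<forall>p x. Im (schr_op (V (fst z)) (snd z p) x * cnj (snd z p x)) \<in> {0}) \<and>
     (\<forall>p. l2_inner (snd z p) (snd z p) \<in> {0, 1}) \<and>
     (\<forall>p q. l2_inner (snd z p) (snd z q) \<in> (if p = q then UNIV else {0})) \<and>
     (\<forall>x. (\<Sum>\<^sub>\<infinity>p. (norm (snd z p x))\<^sup>2) \<in> {1})}"
  have "closed Z"
    unfolding Z_def
    by (intro conj all pre inner parseval continuous_intros H \<Phi>) auto
  then have "closed (fst ` Z)"
    by (rule closed_fst_image[OF \<open>compact K\<close>]) (auto simp: Z_def S_def)
  also have "fst ` Z = {\<omega>. \<exists>\<Phi>. localized_system (V \<omega>) \<alpha> C D \<Phi>}"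
  proof -
    have "(\<omega>, \<Phi>) \<in> Z \<longleftrightarrow> localized_system (V \<omega>) \<alpha> C D \<Phi>" for \<omega> \<Phi>
    proof -
      have "(\<forall>p q. l2_inner (\<Phi> p) (\<Phi> q) \<in> (if p = q then UNIV else {0})) \<longleftrightarrow>
          (\<forall>p q. p \<noteq> q \<longrightarrow> l2_inner (\<Phi> p) (\<Phi> q) = 0)"
        by (simp add: if_distrib[of "\<lambda>A. _ \<in> A"] del: split_paired_All)
      then show ?thesis
        unfolding Z_def S_def K_def localized_system_def
        by (simp only: mem_Collect_eq mem_Times_iff fst_conv snd_conv UNIV_I simp_thms
            singleton_iff right_minus_eq)
    qed
    moreover have "\<omega> \<in> fst ` Z \<longleftrightarrow> (\<exists>\<Phi>. (\<omega>, \<Phi>) \<in> Z)" for \<omega>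
      by (auto intro: rev_image_eqI)
    ultimately show ?thesis
      by blast
  qed
  finally show ?thesis .
qed

section \<open>Translation covariance\<close>

lemma schr_op_translate:
  "schr_op (\<lambda>x. V (lat_add x k)) (\<lambda>x. u (lat_add x k)) n = schr_op V u (lat_add n k)"
proof -
  have "(\<Sum>m\<in>{m. lat_norm (lat_diff m n) = 1}. u (lat_add m k)) =
      (\<Sum>m\<in>{m. lat_norm (lat_diff m (lat_add n k)) = 1}. u m)"
    by (rule sum.reindex_bij_witness[of _ "\<lambda>m. lat_diff m k" "\<lambda>m. lat_add m k"])
      (auto simp: lat_diff_def lat_add_def algebra_simps)
  then show ?thesis
    by (simp add: schr_op_def)
qed

lemma l2_inner_translate:
  "l2_inner (\<lambda>x. u (lat_add x k)) (\<lambda>x. v (lat_add x k)) = l2_inner u v"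
  unfolding l2_inner_def
  using infsum_reindex_bij_betw[OF bij_lat_add_right, of "\<lambda>x. u x * cnj (v x)" k] by simp

text \<open>Sites and centres are shifted together, so their differences, and with them the
  envelope, do not change. Hence the constants \<open>\<alpha>\<close>, \<open>C\<close> and
  \<open>D\<close> are preserved exactly.\<close>

lemma localized_system_translate:
  fixes k :: "'d::finite \<Rightarrow> int"
  assumes \<Phi>: "localized_system V \<alpha> C D \<Phi>"
  shows "localized_system (\<lambda>x. V (lat_add x k)) \<alpha> C D (\<lambda>p x. \<Phi> (lat_add (fst p) k, snd p) (lat_add x k))"
proof -
  define s where "s = (\<lambda>p::('d \<Rightarrow> int) \<times> nat. (lat_add (fst p) k, snd p))"
  have s: "bij s"
    unfolding s_def
    by (rule bij_betw_byWitness[where f' = "\<lambda>p. (lat_diff (fst p) k, snd p)"])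
      (auto simp: lat_diff_def lat_add_def)
  have env: "envelope \<alpha> C D (s p) (lat_add x k) = envelope \<alpha> C D p x" for p x
    by (simp add: envelope_def s_def lat_diff_def lat_add_def)
  have "localized_system (\<lambda>x. V (lat_add x k)) \<alpha> C D (\<lambda>p x. \<Phi> (s p) (lat_add x k))"
    unfolding localized_system_def schr_op_translate l2_inner_translate
  proof (intro conjI allI impI)
    fix p q x y
    show "norm (\<Phi> (s p) (lat_add x k)) \<le> envelope \<alpha> C D p x"
      using localized_systemD(1)[OF \<Phi>, of "s p" "lat_add x k"] by (simp add: env)
    show "schr_op V (\<Phi> (s p)) (lat_add x k) * \<Phi> (s p) (lat_add y k) =
        schr_op V (\<Phi> (s p)) (lat_add y k) * \<Phi> (s p) (lat_add x k)"
      by (rule localized_systemD(2)[OF \<Phi>])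
    show "Im (schr_op V (\<Phi> (s p)) (lat_add x k) * cnj (\<Phi> (s p) (lat_add x k))) = 0"
      by (rule localized_systemD(3)[OF \<Phi>])
    show "l2_inner (\<Phi> (s p)) (\<Phi> (s p)) \<in> {0, 1}"
      using localized_systemD(4)[OF \<Phi>] by blast
    show "l2_inner (\<Phi> (s p)) (\<Phi> (s q)) = 0" if "p \<noteq> q"
      using that s by (intro localized_systemD(5)[OF \<Phi>]) (simp add: bij_def inj_eq)
    show "(\<Sum>\<^sub>\<infinity>p. (norm (\<Phi> (s p) (lat_add x k)))\<^sup>2) = 1"
      using infsum_reindex_bij_betw[OF s, of "\<lambda>p. (norm (\<Phi> p (lat_add x k)))\<^sup>2"]
        localized_systemD(6)[OF \<Phi>, of "lat_add x k"] by simp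
  qed
  then show ?thesis
    by (simp add: s_def)
qed

section \<open>Countable exhaustion and the ergodic dichotomy\<close>

text \<open>Lowering the rate and raising the constant only weakens the bound, so both can be
  rounded to a countable family; the successors keep them positive.\<close>

lemma ULE_imp_localized_system:
  assumes "ULE V"
  shows "\<exists>j c D \<Phi>. localized_system V (1 / real (Suc j)) (real (Suc c)) D \<Phi>"
proof -
  obtain \<alpha> C \<phi> cen where "0 < \<alpha>" "0 < C" and basis: "complete_ON_eigenbasis V \<phi>"
    and bound: "\<And>k m. norm (\<phi> k m) \<le> C * exp (- \<alpha> * lat_norm (lat_diff m (cen k)))"
    using assms unfolding ULE_def ULE_rate_def by blast
  obtain j where j: "1 / real (Suc j) < \<alpha>"
    using reals_Archimedean[OF \<open>0 < \<alpha>\<close>] by (auto simp: inverse_eq_divide)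
  obtain c where c: "C \<le> real c"
    using real_arch_simple by blast
  have bound': "norm (\<phi> k m) \<le> real (Suc c) * exp (- (1 / real (Suc j)) * lat_norm (lat_diff m (cen k)))"
    for k m
  proof (rule order_trans[OF bound])
    have "- \<alpha> * lat_norm (lat_diff m (cen k)) \<le> - (1 / real (Suc j)) * lat_norm (lat_diff m (cen k))"
      using j by (intro mult_right_mono) auto
    then show "C * exp (- \<alpha> * lat_norm (lat_diff m (cen k)))
        \<le> real (Suc c) * exp (- (1 / real (Suc j)) * lat_norm (lat_diff m (cen k)))"
      using c \<open>0 < C\<close> by (intro mult_mono) auto
  qed
  show ?thesis
    by (rule eigenbasis_imp_localized_system[OF _ _ basis bound']) auto
qed

text \<open>Continuity is known for the generators and their inverses. The group law extends it
  along each axis by integer induction, then to \<open>n\<close> by adding one coordinate at a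
  time.\<close>

lemma lattice_action_continuous:
  fixes Tn :: "('d::finite \<Rightarrow> int) \<Rightarrow> 'a::topological_space \<Rightarrow> 'a"
  assumes homeo: "\<And>i. homeomorphism UNIV UNIV (T i) (Tinv i)"
    and zero: "Tn (\<lambda>i. 0) = id"
    and add: "\<And>m n. Tn (lat_add m n) = Tn m \<circ> Tn n"
    and unit: "\<And>i. Tn (lat_unit i) = T i"
  shows "continuous_on UNIV (Tn n)"
proof -
  let ?cont = "\<lambda>n. continuous_on UNIV (Tn n)"
  have cont_add: "?cont (lat_add m n)" if "?cont m" "?cont n" for m n
    unfolding add by (intro continuous_on_compose continuous_on_subset[OF that(1)] that(2)) auto
  have cont_0: "?cont (\<lambda>i. 0)"
    by (simp add: zero)
  have cont_unit: "?cont (lat_unit j)" for j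
    using homeo by (simp add: unit homeomorphism_def)
  have cont_minus_unit: "?cont (\<lambda>i. - lat_unit j i)" for j
  proof -
    \<comment> \<open>The group law makes this map a left inverse of \<open>T j\<close>, so it must
      be the continuous inverse \<open>Tinv j\<close>.\<close>
    have "Tn (\<lambda>i. - lat_unit j i) \<circ> T j = id"
      using add[of "\<lambda>i. - lat_unit j i" "lat_unit j"] by (simp add: lat_add_def zero unit)
    then have "Tn (\<lambda>i. - lat_unit j i) (T j (Tinv j x)) = Tinv j x" for x
      by (metis comp_apply id_apply)
    then have "Tn (\<lambda>i. - lat_unit j i) = Tinv j"
      using homeo[of j] by (auto simp: homeomorphism_def)
    then show ?thesis
      using homeo by (simp add: homeomorphism_def)
  qed
  have cont_axis: "?cont (\<lambda>i. if i = j then k else 0)" for j k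
  proof (induction k rule: int_induct[where k = 0])
    case base
    then show ?case using cont_0 by simp
  next
    case (step1 k)
    have "(\<lambda>i. if i = j then k + 1 else 0) = lat_add (\<lambda>i. if i = j then k else 0) (lat_unit j)"
      by (auto simp: lat_add_def lat_unit_def)
    then show ?case using cont_add[OF step1(2) cont_unit] by simp
  next
    case (step2 k)
    have "(\<lambda>i. if i = j then k - 1 else 0) =
        lat_add (\<lambda>i. if i = j then k else 0) (\<lambda>i. - lat_unit j i)"
      by (auto simp: lat_add_def lat_unit_def)
    then show ?case using cont_add[OF step2(2) cont_minus_unit] by simp
  qed
  have "?cont (\<lambda>i. if i \<in> A then n i else 0)" if "finite A" for A
    using that
  proof (induction A)
    case empty
    then show ?case using cont_0 by simp
  next
    case (insert j A)
    have "(\<lambda>i. if i \<in> insert j A then n i else 0) =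
        lat_add (\<lambda>i. if i \<in> A then n i else 0) (\<lambda>i. if i = j then n j else 0)"
      using insert.hyps by (auto simp: lat_add_def)
    then show ?case using cont_add[OF insert.IH cont_axis] by simp
  qed
  from this[OF finite, of UNIV] show ?thesis by simp
qed

theorem theorem2p2:
  fixes T :: "'d::finite \<Rightarrow> 'a::topological_space \<Rightarrow> 'a"
    and Tinv :: "'d \<Rightarrow> 'a \<Rightarrow> 'a"
    and Tn :: "('d \<Rightarrow> int) \<Rightarrow> 'a \<Rightarrow> 'a"
    and M :: "'a measure"
    and f :: "'a \<Rightarrow> real"
  assumes homeo: "\<And>i. homeomorphism UNIV UNIV (T i) (Tinv i)"
    and commute: "\<And>i j. T i \<circ> T j = T j \<circ> T i"
    and Tn_zero: "Tn (\<lambda>i. 0) = id"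
    and Tn_add: "\<And>m n. Tn (lat_add m n) = Tn m \<circ> Tn n"
    and Tn_unit: "\<And>i. Tn (lat_unit i) = T i"
    and borel_M: "sets M = sets borel"
    and ergodic: "ergodic_action M Tn"
    and f_cont: "continuous_on UNIV f"
    and ule: "AE \<omega> in M. ULE (\<lambda>n. f (Tn n \<omega>))"
  shows "\<exists>\<alpha>>0. AE \<omega> in M. ULE_rate (\<lambda>n. f (Tn n \<omega>)) \<alpha>"
proof -
  define V where "V = (\<lambda>\<omega> n. f (Tn n \<omega>))"
  define S where "S = (\<lambda>j c D. {\<omega>. \<exists>\<Phi>. localized_system (V \<omega>) (1 / real (Suc j)) (real (Suc c)) D \<Phi>})"
  have space: "space M = UNIV"
    using sets_eq_imp_space_eq[OF borel_M] by simp
  have "continuous_on UNIV (\<lambda>\<omega>. V \<omega> n)" for n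
    unfolding V_def
    by (rule continuous_on_compose2[OF f_cont lattice_action_continuous[OF homeo Tn_zero Tn_add Tn_unit]]) simp
  then have S_sets: "S j c D \<in> sets M" for j c D
    unfolding S_def borel_M by (intro borel_closed closed_localized_system) auto
  have V_translate: "V (Tn k \<omega>) = (\<lambda>x. V \<omega> (lat_add x k))" for k \<omega>
    by (simp add: V_def Tn_add)
  have S_step: "Tn k \<omega> \<in> S j c D" if mem: "\<omega> \<in> S j c D" for k \<omega> j c D
  proof -
    obtain \<Phi> where "localized_system (V \<omega>) (1 / real (Suc j)) (real (Suc c)) D \<Phi>"
      using mem unfolding S_def by blast
    from localized_system_translate[OF this, of k] show ?thesis
      unfolding S_def mem_Collect_eq V_translate by blast
  qed
  \<comment> \<open>Ergodicity is stated for sets that equal their preimages. The forward inclusion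
    \<open>S_step\<close> for \<open>- k\<close> gives the converse one for
    \<open>k\<close>.\<close>
  have S_invariant: "Tn k -` S j c D \<inter> space M = S j c D" for k j c D
  proof -
    have "Tn (\<lambda>i. - k i) (Tn k \<omega>) = \<omega>" for \<omega>
      using Tn_add[of "\<lambda>i. - k i" k] by (simp add: lat_add_def Tn_zero fun_eq_iff)
    then have "\<omega> \<in> S j c D" if "Tn k \<omega> \<in> S j c D" for \<omega>
      using S_step[OF that, of "\<lambda>i. - k i"] by simp
    then have "Tn k \<omega> \<in> S j c D \<longleftrightarrow> \<omega> \<in> S j c D" for \<omega>
      using S_step[of \<omega> j c D k] by (rule iffI)
    then show ?thesis
      by (simp add: space set_eq_iff)
  qed
  have dichotomy: "emeasure M (S j c D) = 0 \<or> emeasure M (space M - S j c D) = 0" for j c D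
    using bspec[OF conjunct2[OF ergodic[unfolded ergodic_action_def]] S_sets] S_invariant by blast
  show ?thesis
  proof (cases "\<exists>j c D. emeasure M (space M - S j c D) = 0")
    case True
    then obtain j c D where "emeasure M (space M - S j c D) = 0"
      by blast
    then have "AE \<omega> in M. \<omega> \<in> S j c D"
      using S_sets by (intro AE_I[where N = "space M - S j c D"]) auto
    then have "AE \<omega> in M. ULE_rate (V \<omega>) (1 / real (Suc j))"
    proof (rule AE_mp, intro AE_I2 impI)
      fix \<omega> assume "\<omega> \<in> S j c D"
      then show "ULE_rate (V \<omega>) (1 / real (Suc j))"
        unfolding S_def by (auto intro: localized_system_imp_ULE_rate[of "real (Suc c)"])
    qed
    then show ?thesis
      unfolding V_def by (intro exI[of _ "1 / real (Suc j)"]) simp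
  next
    case False
    \<comment> \<open>All these sets are null, hence so is their countable union, which contains
      every localized \<open>\<omega>\<close>. Thus almost everywhere two contradictory facts hold,
      and the rate 1 below is an arbitrary witness.\<close>
    then have "AE \<omega> in M. \<omega> \<notin> S j c D" for j c D
      using dichotomy S_sets by (intro AE_I[where N = "S j c D"]) auto
    then have "AE \<omega> in M. \<forall>j c D. \<omega> \<notin> S j c D"
      by (simp add: AE_all_countable)
    with ule have "AE \<omega> in M. ULE_rate (\<lambda>n. f (Tn n \<omega>)) 1"
    proof eventually_elim
      case (elim \<omega>)
      then show ?case
        using ULE_imp_localized_system[of "V \<omega>"] unfolding S_def V_def by blast
    qed
    then show ?thesis
      by (intro exI[of _ 1]) simp
  qed
qed

end
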